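(* Let $n\geq 2$, let $f\in\mathcal{H}^n$ and let $X\subseteq R^n$ be a fan. Then $\sum_{x\in R^n}f(x)\mathbf{1}_X(x)=0$ in $\mathbb{Z}/p\mathbb{Z}$.
   Context: Let $p$ be prime, $k\in\mathbb{N}$, $R=\mathbb{Z}/p^k\mathbb{Z}$, $\langle x,b\rangle=\sum_ix_ib_i\in R$. Directions $\mathbb{P}R^{n-1}$: vectors in $R^n$ with some invertible coordinate, modulo multiplication by $R^\times$. Hyperplanes $H_b(a)=\{x:\langle x-a,b\rangle=0\text{ in }R\}$; $\mathcal{H}^n$ is the $\mathbb{Z}/p\mathbb{Z}$-span of the indicators $\mathbf{1}_{H_b(a)}:R^n\to\mathbb{Z}/p\mathbb{Z}$. Canonical directions: $\mathcal{B}=\bigcup_{i=1}^n\mathcal{B}_i$, $\mathcal{B}_i=\{(p\ell_1,\dots,p\ell_{i-1},1,\ell_{i+1},\dots,\ell_n):\ell_j\in R\}$. A line is a set $\{a+tb:t\in R\}$ with $a\in R^n$ and $b$ a direction; every line has this form for a unique $b\in\mathcal{B}$, called its direction. For $b,b'\in\mathcal{B}$, the $p$-adic angle is $\angle(b,b')=p^{-s}$ where $s$ is the largest integer with $p^s$ dividing every coordinate of $b-b'$; $\angle(L,L')$ is the angle of their directions (so $\angle=1$ means $b-b'\not\equiv0\bmod p$). For $0\le\ell\le k$, a cube on scale $\ell$ is $Q_\ell(x)=\{y\in R^n:y\equiv x\bmod p^\ell \text{ coordinatewise}\}$. A 2-plane through $a$ is $a+\{\lambda u+\mu v:\lambda,\mu\in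 R\}$ for $u,v\in\mathcal{B}$ with $\angle(u,v)=1$. For $S\subseteq R^n$ and $j\ge0$, $\mathcal{N}_j(S)=\{x\in R^n:\exists s\in S,\ p^j\mid(x-s)\}$. Fan ($n=2$): let $0\le\ell\le k-2$, let $Q$ be a cube on scale $\ell+1$, $Q'$ the cube on scale $\ell$ containing $Q$, and $L_0,\dots,L_p$ lines each intersecting $Q$ with $\angle(L_i,L_j)=1$ for $i\ne j$; then $X=\bigcup_{i=0}^p(L_i\cap Q')\setminus Q$ is a fan. Fan ($n>2$): let $0\le\ell\le k-2$, $Q'$ a cube on scale $\ell$, $\Pi_0$ a 2-plane through a point $a\in Q'$, $\Pi=Q'\cap\mathcal{N}_{\ell+1}(\Pi_0)$, $Q=Q_{\ell+1}(a)$; let $L_0,\dots,L_p$ be lines each intersecting $Q$, with $\angle(L_i,L_j)=1$ for $i\neq j$, and $L_j\cap Q'\subseteq\Pi$ for all $j$; then $X=\bigcup_{i=0}^p(L_i\cap Q')\setminus Q$ is a fan. *)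

theory Defs
  imports
    "HOL-Analysis.Finite_Cartesian_Product"
    "HOL-Library.Function_Algebras"
    "HOL-Library.Indicator_Function"
    "Berlekamp_Zassenhaus.Finite_Field"
begin

text \<open>
  The ring \<open>R = \<int>/p\<^sup>k\<int>\<close> is \<open>'r mod_ring\<close> with \<open>CARD('r) = p ^ k\<close>, and \<open>R\<^sup>n\<close> is the type
  \<open>('r mod_ring) ^ 'n\<close> with \<open>CARD('n) = n\<close>.  The index type carries a linear order because the
  canonical directions refer to the coordinates before and after a given one.
  Likewise \<open>\<int>/p\<int>\<close> is \<open>'q mod_ring\<close> with \<open>CARD('q) = p\<close>.
\<close>

type_synonym ('r, 'n) rvec = "('r mod_ring) ^ 'n"

definition pairing :: "('r::nontriv, 'n::finite) rvec \<Rightarrow> ('r, 'n) rvec \<Rightarrow> 'r mod_ring" where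
  "pairing x b = (\<Sum>i\<in>UNIV. x $ i * b $ i)"

text \<open>
  Directions are given by representatives: multiplying \<open>b\<close> by a unit of \<open>R\<close> changes neither the
  hyperplane \<open>hyperplane b a\<close> nor the line \<open>line_through a b\<close> below.
\<close>

definition directions :: "('r::nontriv, 'n::finite) rvec set" where
  "directions = {b. \<exists>i. b $ i dvd 1}"

definition hyperplane :: "('r::nontriv, 'n::finite) rvec \<Rightarrow> ('r, 'n) rvec \<Rightarrow> ('r, 'n) rvec set" where
  "hyperplane b a = {x. pairing (x - a) b = 0}"

definition hyperplane_span :: "(('r::nontriv, 'n::finite) rvec \<Rightarrow> 'q::nontriv mod_ring) set" where
  "hyperplane_span =
     Modules.module.span (\<lambda>c g x. c * g x) {indicator (hyperplane b a) | a b. b \<in> directions}"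

lemma module_functions:
  "Modules.module (\<lambda>(c :: 'q::nontriv mod_ring) (g :: 'x \<Rightarrow> 'q mod_ring) x. c * g x)"
  by unfold_locales (auto simp: fun_eq_iff algebra_simps)

definition canonical_directions_at ::
  "nat \<Rightarrow> 'n \<Rightarrow> ('r::nontriv, 'n::{finite,linorder}) rvec set" where
  "canonical_directions_at p i = {b. (\<forall>j<i. of_nat p dvd b $ j) \<and> b $ i = 1}"

definition canonical_directions :: "nat \<Rightarrow> ('r::nontriv, 'n::{finite,linorder}) rvec set" where
  "canonical_directions p = (\<Union>i. canonical_directions_at p i)"

definition line_through :: "('r::nontriv, 'n::finite) rvec \<Rightarrow> ('r, 'n) rvec \<Rightarrow> ('r, 'n) rvec set" where
  "line_through a b = {a + t *s b | t. True}"

definition is_line :: "('r::nontriv, 'n::finite) rvec set \<Rightarrow> bool" where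
  "is_line L \<longleftrightarrow> (\<exists>a. \<exists>b\<in>directions. L = line_through a b)"

text \<open>Well-defined on lines by the lemma \<open>line_canonical_direction\<close> below.\<close>

definition line_direction ::
  "nat \<Rightarrow> ('r::nontriv, 'n::{finite,linorder}) rvec set \<Rightarrow> ('r, 'n) rvec" where
  "line_direction p L = (THE b. b \<in> canonical_directions p \<and> (\<exists>a. L = line_through a b))"

definition cong_pow :: "nat \<Rightarrow> nat \<Rightarrow> ('r::nontriv, 'n::finite) rvec \<Rightarrow> ('r, 'n) rvec \<Rightarrow> bool" where
  "cong_pow p j x y \<longleftrightarrow> (\<forall>i. of_nat p ^ j dvd x $ i - y $ i)"

text \<open>
  The bound \<open>s \<le> k\<close> only matters for \<open>b = b'\<close>, where every power of \<open>p\<close> divides the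
  difference; the angle is then \<open>p\<^sup>-\<^sup>k\<close>.
\<close>

definition angle :: "nat \<Rightarrow> nat \<Rightarrow> ('r::nontriv, 'n::finite) rvec \<Rightarrow> ('r, 'n) rvec \<Rightarrow> real" where
  "angle p k b b' = real p powi (- int (Max {s. s \<le> k \<and> cong_pow p s b b'}))"

definition line_angle ::
  "nat \<Rightarrow> nat \<Rightarrow> ('r::nontriv, 'n::{finite,linorder}) rvec set \<Rightarrow> ('r, 'n) rvec set \<Rightarrow> real" where
  "line_angle p k L L' = angle p k (line_direction p L) (line_direction p L')"

definition cube :: "nat \<Rightarrow> nat \<Rightarrow> ('r::nontriv, 'n::finite) rvec \<Rightarrow> ('r, 'n) rvec set" where
  "cube p l x = {y. cong_pow p l y x}"

definition is_two_plane_through ::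
  "nat \<Rightarrow> nat \<Rightarrow> ('r::nontriv, 'n::{finite,linorder}) rvec \<Rightarrow> ('r, 'n) rvec set \<Rightarrow> bool" where
  "is_two_plane_through p k a P \<longleftrightarrow>
     (\<exists>u\<in>canonical_directions p. \<exists>v\<in>canonical_directions p. angle p k u v = 1 \<and>
        P = {a + (c *s u + d *s v) | c d. True})"

definition nbhd :: "nat \<Rightarrow> nat \<Rightarrow> ('r::nontriv, 'n::finite) rvec set \<Rightarrow> ('r, 'n) rvec set" where
  "nbhd p j S = {x. \<exists>s\<in>S. cong_pow p j x s}"

text \<open>In both definitions the lines \<open>L\<^sub>0, \<dots>, L\<^sub>p\<close> are the values of \<open>L :: nat \<Rightarrow> _\<close> at \<open>0, \<dots>, p\<close>.\<close>

definition is_fan_planar ::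
  "nat \<Rightarrow> nat \<Rightarrow> ('r::nontriv, 'n::{finite,linorder}) rvec set \<Rightarrow> bool" where
  "is_fan_planar p k X \<longleftrightarrow>
     (\<exists>l Q Q' L.
        l + 2 \<le> k \<and>
        (\<exists>x. Q = cube p (l + 1) x) \<and>
        (\<exists>x. Q' = cube p l x) \<and> Q \<subseteq> Q' \<and>
        (\<forall>i\<le>p. is_line (L i) \<and> L i \<inter> Q \<noteq> {}) \<and>
        (\<forall>i\<le>p. \<forall>j\<le>p. i \<noteq> j \<longrightarrow> line_angle p k (L i) (L j) = 1) \<and>
        X = (\<Union>i\<le>p. L i \<inter> Q') - Q)"

definition is_fan_higher ::
  "nat \<Rightarrow> nat \<Rightarrow> ('r::nontriv, 'n::{finite,linorder}) rvec set \<Rightarrow> bool" where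
  "is_fan_higher p k X \<longleftrightarrow>
     (\<exists>l Q Q' a P\<^sub>0 P L.
        l + 2 \<le> k \<and>
        (\<exists>x. Q' = cube p l x) \<and>
        a \<in> Q' \<and> is_two_plane_through p k a P\<^sub>0 \<and>
        P = Q' \<inter> nbhd p (l + 1) P\<^sub>0 \<and>
        Q = cube p (l + 1) a \<and>
        (\<forall>i\<le>p. is_line (L i) \<and> L i \<inter> Q \<noteq> {}) \<and>
        (\<forall>i\<le>p. \<forall>j\<le>p. i \<noteq> j \<longrightarrow> line_angle p k (L i) (L j) = 1) \<and>
        (\<forall>j\<le>p. L j \<inter> Q' \<subseteq> P) \<and>
        X = (\<Union>i\<le>p. L i \<inter> Q') - Q)"

definition is_fan :: "nat \<Rightarrow> nat \<Rightarrow> ('r::nontriv, 'n::{finite,linorder}) rvec set \<Rightarrow> bool" where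
  "is_fan p k X \<longleftrightarrow> (if CARD('n) = 2 then is_fan_planar p k X else is_fan_higher p k X)"

lemma mod_ring_prime_not_unit:
  assumes "CARD('r::nontriv) = p ^ k"
  shows "\<not> (of_nat p :: 'r mod_ring) dvd 1"
proof
  assume "(of_nat p :: 'r mod_ring) dvd 1"
  then have "(of_nat p :: 'r mod_ring) ^ k dvd 1 ^ k" by (rule dvd_power_same)
  moreover have "(of_nat p :: 'r mod_ring) ^ k = 0"
    using of_nat_card_eq_0[where 'a = 'r] assms by simp
  ultimately show False by simp
qed

lemma mod_ring_unit_or_dvd:
  fixes x :: "'r::nontriv mod_ring"
  assumes "prime p" and "CARD('r) = p ^ k"
  shows "x dvd 1 \<or> of_nat p dvd x"
proof -
  obtain z :: int where z: "x = of_int z"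
    by (metis of_int_mod_ring_to_int_mod_ring of_int_of_int_mod_ring)
  show ?thesis
  proof (cases "int p dvd z")
    case True
    then obtain w where "z = int p * w" ..
    then show ?thesis by (simp add: z)
  next
    case False
    then have "coprime z (int p)"
      using assms(1) by (metis coprime_commute prime_imp_coprime prime_nat_int_transfer)
    then have "coprime z (int p ^ k)" by simp
    then obtain u v where "u * z + v * int p ^ k = 1"
      using bezout_int[of z "int p ^ k"] by (auto simp: coprime_iff_gcd_eq_1)
    then have "of_int (u * z + v * int p ^ k) = (1 :: 'r mod_ring)" by simp
    moreover have "(of_nat p :: 'r mod_ring) ^ k = 0"
      using of_nat_card_eq_0[where 'a = 'r] assms(2) by simp
    ultimately have "of_int u * x = 1" by (simp add: z)
    then show ?thesis by (metis dvd_triv_right)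
  qed
qed

lemma line_canonical_direction:
  fixes L :: "('r::nontriv, 'n::{finite,linorder}) rvec set"
  assumes "prime p" and "CARD('r) = p ^ k" and "is_line L"
  shows "\<exists>!b. b \<in> canonical_directions p \<and> (\<exists>a. L = line_through a b)"
proof (rule ex_ex1I)
  obtain a b where b: "b \<in> directions" and L: "L = line_through a b"
    using assms(3) by (auto simp: is_line_def)
  define U where "U = {i. b $ i dvd 1}"
  have U: "U \<noteq> {}" "finite U" using b by (auto simp: U_def directions_def)
  define i where "i = Min U"
  have "i \<in> U" unfolding i_def using U by simp
  then obtain w where w: "1 = b $ i * w" by (auto simp: U_def)
  have "of_nat p dvd (w *s b) $ j" if "j < i" for j
  proof -
    have "j \<notin> U" using that U unfolding i_def by auto
    then have "of_nat p dvd b $ j" using mod_ring_unit_or_dvd[OF assms(1,2)] by (auto simp: U_def)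
    then show ?thesis by simp
  qed
  then have "w *s b \<in> canonical_directions p"
    using w by (auto simp: canonical_directions_def canonical_directions_at_def mult.commute)
  moreover have "L = line_through a (w *s b)"
  proof -
    have "t *s b = (t * b $ i) *s (w *s b)" for t
      using w by (simp add: vector_smult_assoc mult.assoc)
    then show ?thesis unfolding L line_through_def
      by (auto simp: vector_smult_assoc) metis+
  qed
  ultimately show "\<exists>b. b \<in> canonical_directions p \<and> (\<exists>a. L = line_through a b)" by blast
next
  have mult: "\<exists>t. c = t *s b" if eq: "line_through a b = line_through a' c"
    for a a' b c :: "('r, 'n) rvec"
  proof -
    have "a' + 0 *s c \<in> line_through a' c" "a' + 1 *s c \<in> line_through a' c"
      unfolding line_through_def by blast+
    then obtain s t where "a' = a + s *s b" "a' + c = a + t *s b"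
      unfolding eq[symmetric] by (auto simp: line_through_def)
    then have "c = (t - s) *s b" by (simp add: vector_sub_rdistrib algebra_simps)
    then show ?thesis ..
  qed
  have le: "i \<le> j" if "\<forall>l<i. of_nat p dvd b $ l" "c $ j = 1" "c = t *s b"
    for b c :: "('r, 'n) rvec" and i j t
  proof (rule ccontr)
    assume "\<not> i \<le> j"
    then have "of_nat p dvd b $ j" using that(1) by simp
    then have "of_nat p dvd c $ j" unfolding that(3) by simp
    then show False using that(2) mod_ring_prime_not_unit[OF assms(2)] by simp
  qed
  fix b c :: "('r, 'n) rvec"
  assume b: "b \<in> canonical_directions p \<and> (\<exists>a. L = line_through a b)"
    and c: "c \<in> canonical_directions p \<and> (\<exists>a. L = line_through a c)"
  obtain s t where st: "c = t *s b" "b = s *s c" using b c mult by metis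
  obtain i j where i: "\<forall>l<i. of_nat p dvd b $ l" "b $ i = 1"
    and j: "\<forall>l<j. of_nat p dvd c $ l" "c $ j = 1"
    using b c by (auto simp: canonical_directions_def canonical_directions_at_def)
  have "i = j" using le[OF i(1) j(2) st(1)] le[OF j(1) i(2) st(2)] by simp
  then have "t = 1" using i(2) j(2) st(1) by simp
  then show "b = c" using st(1) by simp
qed

end

theory Submission
  imports Defs
begin

text \<open>
  It suffices to show that a hyperplane \<open>H = {y. \<langle>y - x, e\<rangle> = 0}\<close> meets the fan in a multiple of \<open>p\<close>
  points.  Fix \<open>q\<^sub>i \<in> L\<^sub>i \<inter> Q\<close> and let \<open>b\<^sub>i\<close> be the canonical direction of \<open>L\<^sub>i\<close>.  The fan is the disjoint
  union of the sets of points \<open>q\<^sub>i + t b\<^sub>i\<close> with \<open>t\<close> divisible by exactly \<open>p\<^sup>l\<close>, and such a point lies on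
  \<open>H\<close> iff \<open>\<langle>q\<^sub>i - x, e\<rangle> + t \<langle>b\<^sub>i, e\<rangle> = 0\<close>.  If \<open>p\<close> divides \<open>\<langle>b\<^sub>i, e\<rangle>\<close>, the number of solutions is a
  multiple of \<open>p\<close>.  Otherwise there is a single \<open>t\<close>, admissible iff \<open>\<langle>q\<^sub>i - x, e\<rangle>\<close> is divisible by
  exactly \<open>p\<^sup>l\<close>, which does not depend on \<open>i\<close> because the \<open>q\<^sub>i\<close> agree modulo \<open>p\<^sup>l\<^sup>+\<^sup>1\<close>.  Modulo \<open>p\<close> the
  directions \<open>b\<^sub>i\<close> are all \<open>p + 1\<close> points of a projective line, so the number of \<open>i\<close> with
  \<open>\<langle>b\<^sub>i, e\<rangle>\<close> nonzero modulo \<open>p\<close> is \<open>0\<close> or \<open>p\<close>.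
\<close>

section \<open>Arithmetic of R through integer lifts, and its reduction to Z/p\<close>

lemma of_int_mod_ring_eq_iff:
  "(of_int x :: 'a::nontriv mod_ring) = of_int y \<longleftrightarrow> int CARD('a) dvd x - y"
  by transfer (simp add: mod_eq_dvd_iff)

lemma mod_ring_obtain_int:
  fixes x :: "'a::nontriv mod_ring"
  obtains z where "x = of_int z"
  by (metis of_int_mod_ring_to_int_mod_ring of_int_of_int_mod_ring)

locale prime_power_residues =
  fixes p k :: nat and R :: "'r::nontriv itself" and F :: "'q::nontriv itself"
  assumes prime_p: "prime p" and card_R: "CARD('r) = p ^ k" and card_F: "CARD('q) = p"
begin

lemma k_pos: "k > 0"
  using nontriv[where 'a = 'r] card_R by (cases k) auto

text \<open>As p^j divides the modulus p^k, divisibility by p^j does not depend on the integer lift.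
  For j > k the element p^j is already 0 in R and the equivalence breaks.\<close>

lemma pow_dvd_of_int_iff:
  assumes "j \<le> k"
  shows "(of_nat p ^ j :: 'r mod_ring) dvd of_int z \<longleftrightarrow> int p ^ j dvd z"
proof
  assume "(of_nat p ^ j :: 'r mod_ring) dvd of_int z"
  then obtain y :: "'r mod_ring" where y: "of_int z = of_nat p ^ j * y" ..
  obtain w where "y = of_int w" by (rule mod_ring_obtain_int)
  with y have "(of_int z :: 'r mod_ring) = of_int (int p ^ j * w)" by simp
  then have "int p ^ k dvd z - int p ^ j * w"
    by (simp add: of_int_mod_ring_eq_iff card_R del: of_int_mult of_int_power)
  then have "int p ^ j dvd z - int p ^ j * w" using assms by (meson dvd_trans le_imp_power_dvd)
  then have "int p ^ j dvd (z - int p ^ j * w) + int p ^ j * w" by (intro dvd_add) auto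
  then show "int p ^ j dvd z" by simp
next
  assume "int p ^ j dvd z"
  then obtain w where "z = int p ^ j * w" ..
  then show "(of_nat p ^ j :: 'r mod_ring) dvd of_int z" by simp
qed

text \<open>Powers of p are zero divisors in R, so the cancellation takes place on an integer lift;
  \<open>j < k\<close> ensures that p^(j+1) is still visible modulo p^k.\<close>

lemma pow_Suc_dvd_cancel:
  fixes x :: "'r mod_ring"
  assumes "of_nat p ^ Suc j dvd of_nat p ^ j * x" and "j < k"
  shows "of_nat p dvd x"
proof -
  obtain z where z: "x = of_int z" by (rule mod_ring_obtain_int)
  have "(of_nat p ^ Suc j :: 'r mod_ring) dvd of_int (int p ^ j * z)"
    using assms(1) by (simp add: z)
  then have "int p ^ Suc j dvd int p ^ j * z"
    using pow_dvd_of_int_iff[of "Suc j"] assms(2) by (simp del: of_int_mult of_int_power)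
  then have "int p dvd z"
    using prime_gt_0_nat[OF prime_p] by (simp add: mult.commute[of "int p"])
  then obtain w where "z = int p * w" ..
  then show ?thesis by (simp add: z)
qed

text \<open>The ring homomorphism from R to Z/p, computed on one representative. Any other gives the
  same value because p divides p^k, which is \<open>red_of_int\<close>.\<close>

definition red :: "'r mod_ring \<Rightarrow> 'q mod_ring" where
  "red x = of_int (to_int_mod_ring x)"

lemma red_of_int [simp]: "red (of_int z) = of_int z"
proof -
  have "(of_int (to_int_mod_ring (of_int z :: 'r mod_ring)) :: 'r mod_ring) = of_int z"
    by (metis of_int_mod_ring_to_int_mod_ring of_int_of_int_mod_ring)
  then have "int p ^ k dvd to_int_mod_ring (of_int z :: 'r mod_ring) - z"
    by (simp add: of_int_mod_ring_eq_iff card_R)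
  then have "int p dvd to_int_mod_ring (of_int z :: 'r mod_ring) - z"
    using k_pos by (meson dvd_power dvd_trans)
  then show ?thesis by (simp add: red_def of_int_mod_ring_eq_iff card_F)
qed

lemma red_0 [simp]: "red 0 = 0" and red_1 [simp]: "red 1 = 1"
  using red_of_int[of 0] red_of_int[of 1] by simp_all

lemma red_add [simp]: "red (x + y) = red x + red y"
proof -
  obtain z w where "x = of_int z" "y = of_int w" by (metis mod_ring_obtain_int)
  then show ?thesis using red_of_int[of "z + w"] by simp
qed

lemma red_mult [simp]: "red (x * y) = red x * red y"
proof -
  obtain z w where "x = of_int z" "y = of_int w" by (metis mod_ring_obtain_int)
  then show ?thesis using red_of_int[of "z * w"] by simp
qed

lemma red_diff [simp]: "red (x - y) = red x - red y"
  using red_add[of "x - y" y] by (simp add: eq_diff_eq)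

lemma red_sum [simp]: "red (\<Sum>i\<in>A. g i) = (\<Sum>i\<in>A. red (g i))"
  by (induction A rule: infinite_finite_induct) auto

lemma red_eq_0_iff: "red x = 0 \<longleftrightarrow> of_nat p dvd x"
proof -
  obtain z where z: "x = of_int z" by (rule mod_ring_obtain_int)
  have "of_nat p dvd x \<longleftrightarrow> int p dvd z"
    using pow_dvd_of_int_iff[of 1 z] k_pos by (simp add: z)
  moreover have "red x = 0 \<longleftrightarrow> int p dvd z"
    using of_int_mod_ring_eq_iff[of z 0, where 'a = 'q] by (simp add: z card_F)
  ultimately show ?thesis by simp
qed

text \<open>R is a local ring whose maximal ideal is generated by p.\<close>

lemma dvd_1_iff_red: "x dvd 1 \<longleftrightarrow> red x \<noteq> 0"
  unfolding red_eq_0_iff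
  using mod_ring_unit_or_dvd[OF prime_p card_R, of x] mod_ring_prime_not_unit[OF card_R]
    dvd_trans[of "of_nat p" x 1] by blast

text \<open>The dichotomy \<open>mod_ring_unit_or_dvd\<close> at exponent 1, where p = 0 and so the
  only multiple of p is 0.\<close>

lemma F_inverse:
  fixes x :: "'q mod_ring"
  assumes "x \<noteq> 0"
  shows "\<exists>w. x * w = 1"
proof -
  have "(of_nat p :: 'q mod_ring) = 0" using of_nat_card_eq_0[where 'a = 'q] card_F by simp
  then have "x dvd 1" using mod_ring_unit_or_dvd[OF prime_p, of 1 x] card_F assms by simp
  then show ?thesis by (metis dvdE)
qed

lemma F_mult_eq_0_iff:
  fixes x y :: "'q mod_ring"
  shows "x * y = 0 \<longleftrightarrow> x = 0 \<or> y = 0"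
proof
  assume xy: "x * y = 0"
  show "x = 0 \<or> y = 0"
  proof (rule disjCI)
    assume "y \<noteq> 0"
    then obtain w where "y * w = 1" using F_inverse by blast
    then have "x = x * y * w" by (simp add: mult.assoc)
    then show "x = 0" by (simp add: xy)
  qed
qed auto

section \<open>Directions as points of a projective space over Z/p\<close>

lemma canonical_red:
  fixes b :: "('r, 'n::{finite,linorder}) rvec"
  assumes "b \<in> canonical_directions p"
  obtains i where "b $ i = 1" "\<forall>j<i. red (b $ j) = 0"
proof -
  obtain i where "b $ i = 1" "\<forall>j<i. of_nat p dvd b $ j"
    using assms by (auto simp: canonical_directions_def canonical_directions_at_def)
  then show thesis using that[of i] by (simp add: red_eq_0_iff)
qed

lemma canonical_coordinate_1:
  fixes b :: "('r, 'n::{finite,linorder}) rvec"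
  shows "b \<in> canonical_directions p \<Longrightarrow> \<exists>m. b $ m = 1"
  by (auto simp: canonical_directions_def canonical_directions_at_def)

text \<open>A canonical direction is a normal form of its projective point modulo p: the first
  nonzero coordinate is 1. Proportional vectors share that leading index, and comparing coordinates
  there forces \<open>x = y\<close>.\<close>

lemma canonical_proportional_red_eq:
  fixes b c :: "('r, 'n::{finite,linorder}) rvec"
  assumes b: "b \<in> canonical_directions p" and c: "c \<in> canonical_directions p"
    and eq: "\<And>m. x * red (b $ m) = y * red (c $ m)" and "x \<noteq> 0"
  shows "red (b $ m) = red (c $ m)"
proof -
  obtain i where i: "b $ i = 1" "\<forall>j<i. red (b $ j) = 0" by (rule canonical_red[OF b])
  obtain j where j: "c $ j = 1" "\<forall>m<j. red (c $ m) = 0" by (rule canonical_red[OF c])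
  have "y \<noteq> 0" using eq[of i] i \<open>x \<noteq> 0\<close> by auto
  have "\<not> i < j" using eq[of i] i(1) j(2) \<open>x \<noteq> 0\<close> by auto
  moreover have "\<not> j < i" using eq[of j] j(1) i(2) \<open>y \<noteq> 0\<close> by auto
  ultimately have "i = j" by simp
  then have "x = y" using eq[of i] i(1) j(1) by simp
  then have "x * (red (b $ m) - red (c $ m)) = 0" using eq[of m] by (simp add: algebra_simps)
  then show ?thesis using \<open>x \<noteq> 0\<close> by (simp add: F_mult_eq_0_iff)
qed

text \<open>The pairs \<open>(c\<^sub>i, d\<^sub>i)\<close> represent all \<open>p + 1\<close> points of the projective line over \<open>\<int>/p\<int>\<close>, and
  a nonzero linear form vanishes at exactly one of them.\<close>

lemma card_projective_line_nonzero:
  fixes c d :: "nat \<Rightarrow> 'q mod_ring"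
  assumes det: "\<And>i j. i \<le> p \<Longrightarrow> j \<le> p \<Longrightarrow> i \<noteq> j \<Longrightarrow> c i * d j - c j * d i \<noteq> 0"
  shows "p dvd card {i. i \<le> p \<and> c i * r + d i * s \<noteq> 0}"
proof (cases "r = 0 \<and> s = 0")
  case True
  then show ?thesis by simp
next
  case False
  \<comment> \<open>A second, independent linear form. The values \<open>x i\<close>,
    \<open>y i\<close> of the two forms are new coordinates, which change all determinants by the
    same nonzero factor.\<close>
  then obtain r' s' where comp: "r * s' - s * r' \<noteq> 0"
  proof (cases "r = 0")
    case True
    with False show ?thesis using that[of 0 1] by simp
  next
    case False
    then show ?thesis using that[of 1 0] by simp
  qed
  define x where "x i = c i * r + d i * s" for i
  define y where "y i = c i * r' + d i * s'" for i
  have det': "x i * y j - x j * y i \<noteq> 0" if "i \<le> p" "j \<le> p" "i \<noteq> j" for i j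
  proof -
    have "x i * y j - x j * y i = (c i * d j - c j * d i) * (r * s' - s * r')"
      unfolding x_def y_def by (simp add: algebra_simps)
    then show ?thesis using det[OF that] comp by (simp add: F_mult_eq_0_iff)
  qed
  define S where "S = {i. i \<le> p \<and> x i \<noteq> 0}"
  define Z where "Z = {i. i \<le> p \<and> x i = 0}"
  define w where "w i = (SOME v. x i * v = 1)" for i
  have w: "x i * w i = 1" if "x i \<noteq> 0" for i
    unfolding w_def using F_inverse[OF that] by (rule someI_ex)
  \<comment> \<open>The ratio of \<open>y i\<close> to \<open>x i\<close> is an affine coordinate
    where \<open>x i\<close> is nonzero, and it takes at most p values.\<close>
  have "inj_on (\<lambda>i. y i * w i) S"
  proof (rule inj_onI, rule ccontr)
    fix i j
    assume ij: "i \<in> S" "j \<in> S" and eq: "y i * w i = y j * w j" and "i \<noteq> j"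
    have "x i * y j = x i * y j * (x j * w j)" using w[of j] ij(2) unfolding S_def by simp
    also have "\<dots> = x i * x j * (y j * w j)" by (simp add: ac_simps)
    also have "\<dots> = x j * y i * (x i * w i)" unfolding eq[symmetric] by (simp add: ac_simps)
    also have "\<dots> = x j * y i" using w[of i] ij(1) unfolding S_def by simp
    finally show False using det'[of i j] ij \<open>i \<noteq> j\<close> by (simp add: S_def)
  qed
  then have "card S \<le> CARD('q mod_ring)" by (metis card_inj_on_le finite subset_UNIV)
  moreover have "card Z \<le> 1"
  proof -
    have "i = j" if "i \<in> Z" "j \<in> Z" for i j
      using det'[of i j] that by (auto simp: Z_def)
    moreover have "finite Z" by (simp add: Z_def)
    ultimately show ?thesis by (simp add: card_le_Suc0_iff_eq)
  qed
  moreover have "card S + card Z = p + 1"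
  proof -
    have "card (S \<union> Z) = card S + card Z" by (rule card_Un_disjoint) (auto simp: S_def Z_def)
    moreover have "S \<union> Z = {..p}" by (auto simp: S_def Z_def)
    ultimately show ?thesis by simp
  qed
  ultimately have "card S = p \<or> card S = p + 1" "card S \<le> p" by (auto simp: card_F)
  then show ?thesis by (simp add: S_def x_def)
qed

section \<open>Solutions of linear equations in R, counted modulo p\<close>

text \<open>The multiples of p^(k-1) form an additive group of order p acting freely by translation,
  so \<open>S\<close> splits into orbits of p elements. Each orbit has exactly one representative
  below \<open>M\<close>, and these representatives form \<open>A\<close>.\<close>

lemma card_periodic_dvd:
  fixes S :: "'r mod_ring set"
  assumes periodic: "\<And>t. t + of_nat (p ^ (k - 1)) \<in> S \<longleftrightarrow> t \<in> S"
  shows "p dvd card S"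
proof -
  define M where "M = p ^ (k - 1)"
  have M: "M > 0" "p ^ k = M * p"
    using prime_gt_0_nat[OF prime_p] power_minus_mult[OF k_pos, of p] by (auto simp: M_def)
  have periodic': "of_nat (r + M * m) \<in> S \<longleftrightarrow> of_nat r \<in> S" for r m
  proof (induction m)
    case (Suc m)
    have eq: "(of_nat (r + M * Suc m) :: 'r mod_ring) = of_nat (r + M * m) + of_nat (p ^ (k - 1))"
      by (simp add: M_def algebra_simps)
    show ?case unfolding eq periodic by (rule Suc)
  qed simp
  define A where "A = {r. r < M \<and> of_nat r \<in> S}"
  define h :: "nat \<times> nat \<Rightarrow> 'r mod_ring" where "h = (\<lambda>(r, m). of_nat (r + M * m))"
  have "bij_betw h (A \<times> {..<p}) S"
  proof (rule bij_betw_imageI)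
    have lt: "r + M * m < p ^ k" if "r < M" "m < p" for r m
    proof -
      have "r + M * m < M * Suc m" using that by simp
      also have "\<dots> \<le> M * p" using that by (intro mult_le_mono2) simp
      finally show ?thesis by (simp add: M)
    qed
    show "inj_on h (A \<times> {..<p})"
    proof (rule inj_onI, clarify)
      fix r m r' m'
      assume *: "r \<in> A" "r' \<in> A" "m < p" "m' < p" and "h (r, m) = h (r', m')"
      then have "(of_int (int (r + M * m)) :: 'r mod_ring) = of_int (int (r' + M * m'))"
        by (simp add: h_def)
      then have "int (r + M * m) mod int (p ^ k) = int (r' + M * m') mod int (p ^ k)"
        unfolding of_int_mod_ring_eq_iff card_R by (simp only: mod_eq_dvd_iff)
      then have "(r + M * m) mod p ^ k = (r' + M * m') mod p ^ k"
        by (metis of_nat_eq_iff of_nat_mod)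
      then have eq: "r + M * m = r' + M * m'" using lt * by (simp add: A_def)
      have "r < M" "r' < M" using * by (auto simp: A_def)
      then have "r = r'" using arg_cong[OF eq, of "\<lambda>x. x mod M"] by simp
      then show "r = r' \<and> m = m'" using eq M by simp
    qed
    show "h ` (A \<times> {..<p}) = S"
    proof
      show "h ` (A \<times> {..<p}) \<subseteq> S"
        using periodic' by (auto simp: h_def A_def simp del: of_nat_add of_nat_mult)
      show "S \<subseteq> h ` (A \<times> {..<p})"
      proof
        fix t assume t: "t \<in> S"
        obtain z where z: "t = of_int z" by (rule mod_ring_obtain_int)
        define n where "n = nat (z mod int (p ^ k))"
        have pos: "int (p ^ k) > 0" using prime_gt_0_nat[OF prime_p] by simp
        have n: "int n = z mod int (p ^ k)" using pos by (simp add: n_def)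
        have "n < p ^ k" using pos n by (metis of_nat_less_iff pos_mod_bound)
        moreover have "t = of_nat n"
        proof -
          have "(of_int z :: 'r mod_ring) = of_int (int n)"
            unfolding of_int_mod_ring_eq_iff card_R n by (metis dvd_minus_mod)
          then show ?thesis using z by simp
        qed
        moreover have "n = n mod M + M * (n div M)" by simp
        ultimately have "t = h (n mod M, n div M)" "n div M < p" "n mod M \<in> A"
          using t periodic'[of "n mod M" "n div M"] M
          by (auto simp: h_def A_def less_mult_imp_div_less mult.commute simp del: of_nat_add of_nat_mult)
        then show "t \<in> h ` (A \<times> {..<p})" by blast
      qed
    qed
  qed
  then have "card S = card A * p" by (metis bij_betw_same_card card_cartesian_product card_lessThan)
  then show ?thesis by simp
qed

lemma of_nat_F_eq_0: "p dvd n \<Longrightarrow> (of_nat n :: 'q mod_ring) = 0"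
  using of_nat_card_eq_0[where 'a = 'q] card_F by (auto simp: dvd_def)

text \<open>If \<open>p\<close> divides \<open>d\<close>, the solution set is invariant under translation by \<open>p\<^sup>k\<^sup>-\<^sup>1\<close>; this is where
  \<open>l + 2 \<le> k\<close> is needed.\<close>

lemma card_line_solutions:
  fixes c d :: "'r mod_ring"
  assumes "l + 2 \<le> k"
  shows "(of_nat (card {t. c + t * d = 0 \<and> of_nat p ^ l dvd t \<and> \<not> of_nat p ^ (l + 1) dvd t})
      :: 'q mod_ring) = (if red d \<noteq> 0 \<and> of_nat p ^ l dvd c \<and> \<not> of_nat p ^ (l + 1) dvd c then 1 else 0)"
    (is "of_nat (card ?S) = _")
proof (cases "red d = 0")
  case True
  then obtain d' where d': "d = of_nat p * d'" by (auto simp: red_eq_0_iff)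
  define P :: "'r mod_ring" where "P = of_nat (p ^ (k - 1))"
  have "P * d = of_nat (p ^ (k - 1) * p) * d'" by (simp add: P_def d')
  also have "\<dots> = 0"
    using power_minus_mult[OF k_pos, of p] of_nat_card_eq_0[where 'a = 'r] card_R by simp
  finally have "P * d = 0" .
  then have eq: "c + (t + P) * d = c + t * d" for t by (simp add: distrib_right)
  have "of_nat p ^ j dvd P" if "j \<le> l + 1" for j
    unfolding P_def of_nat_power by (rule le_imp_power_dvd) (use that assms in simp)
  then have shift: "of_nat p ^ j dvd t + P \<longleftrightarrow> of_nat p ^ j dvd t" if "j \<le> l + 1" for j t
    using that by (simp add: dvd_add_left_iff)
  have "t + P \<in> ?S \<longleftrightarrow> t \<in> ?S" for t
    unfolding mem_Collect_eq eq shift[OF le_add1] shift[OF order_refl] ..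
  then have "p dvd card ?S" unfolding P_def by (rule card_periodic_dvd)
  then show ?thesis using True by (simp add: of_nat_F_eq_0)
next
  case False
  then obtain w where w: "1 = d * w" using dvd_1_iff_red by (metis dvdE)
  have sol: "c + t * d = 0 \<longleftrightarrow> t = - (c * w)" for t
  proof
    assume "c + t * d = 0"
    then have "t * d * w = - (c * w)"
      by (simp add: eq_neg_iff_add_eq_0 flip: distrib_right) (simp add: add.commute)
    then show "t = - (c * w)" using w by (simp add: mult.assoc)
  next
    assume "t = - (c * w)"
    then show "c + t * d = 0" using w by (simp add: mult.assoc mult.commute[of w])
  qed
  \<comment> \<open>\<open>w\<close> is a unit with inverse \<open>d\<close>, so multiplication by
    it preserves divisibility in both directions.\<close>
  have dvd: "of_nat p ^ j dvd - (c * w) \<longleftrightarrow> of_nat p ^ j dvd c" for j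
  proof
    assume "of_nat p ^ j dvd - (c * w)"
    then have "of_nat p ^ j dvd c * w * d" by simp
    then show "of_nat p ^ j dvd c" using w by (simp add: mult.assoc mult.commute[of w])
  qed simp
  have "?S = (if of_nat p ^ l dvd c \<and> \<not> of_nat p ^ (l + 1) dvd c then {- (c * w)} else {})"
    unfolding sol dvd[symmetric] by (split if_split) blast
  then show ?thesis using False by simp
qed

section \<open>Lines, cubes and pairings under congruences\<close>

lemma cong_pow_mono:
  fixes x y :: "('r, 'n::finite) rvec"
  assumes "cong_pow p m x y" and "j \<le> m"
  shows "cong_pow p j x y"
  using assms(1) dvd_trans[OF le_imp_power_dvd[OF assms(2)]] unfolding cong_pow_def by blast

text \<open>\<open>q\<close> is congruent to \<open>a\<close> at all scales up to
  \<open>l + 1\<close>, so only the displacement matters, and a coordinate where \<open>b\<close> is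
  1 displays \<open>t\<close> itself.\<close>

lemma line_mem_cube_iff:
  fixes b :: "('r, 'n::{finite,linorder}) rvec"
  assumes "q \<in> cube p (l + 1) a" and "j \<le> l + 1" and "b \<in> canonical_directions p"
  shows "q + t *s b \<in> cube p j a \<longleftrightarrow> of_nat p ^ j dvd t"
proof -
  have "cong_pow p j q a" using cong_pow_mono[OF _ assms(2)] assms(1) unfolding cube_def by blast
  then have "of_nat p ^ j dvd q $ i - a $ i" for i by (simp add: cong_pow_def)
  then have "of_nat p ^ j dvd (q $ i - a $ i) + t * b $ i \<longleftrightarrow> of_nat p ^ j dvd t * b $ i" for i
    by (rule dvd_add_right_iff)
  moreover have "(q + t *s b) $ i - a $ i = (q $ i - a $ i) + t * b $ i" for i by simp
  moreover obtain m where "b $ m = 1" using canonical_coordinate_1[OF assms(3)] ..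
  ultimately show ?thesis
    unfolding cube_def cong_pow_def mem_Collect_eq by (metis dvd_mult2 mult.right_neutral)
qed

lemma pairing_line:
  fixes b :: "('r, 'n::finite) rvec"
  shows "pairing (q + t *s b - x) e = pairing (q - x) e + t * pairing b e"
  by (simp add: pairing_def sum_distrib_left algebra_simps flip: sum.distrib)

lemma pow_dvd_pairing:
  fixes x y :: "('r, 'n::finite) rvec"
  assumes "cong_pow p j x y"
  shows "of_nat p ^ j dvd pairing (x - z) e \<longleftrightarrow> of_nat p ^ j dvd pairing (y - z) e"
proof -
  have "pairing (x - z) e = pairing (x - y) e + pairing (y - z) e"
    by (simp add: pairing_def algebra_simps flip: sum.distrib)
  moreover have "of_nat p ^ j dvd pairing (x - y) e"
    using assms unfolding pairing_def cong_pow_def by (auto intro!: dvd_sum dvd_mult2)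
  ultimately show ?thesis by (simp add: dvd_add_right_iff)
qed

section \<open>Points of a fan on a hyperplane\<close>

text \<open>This form covers fans in every dimension: by \<open>coord\<close> the directions modulo
  p lie in the span of \<open>u\<close> and \<open>v\<close>, so p + 1 distinct ones exhaust a
  projective line.\<close>

lemma fan_inter_hyperplane_card:
  fixes a :: "('r, 'n::{finite,linorder}) rvec"
  assumes l: "l + 2 \<le> k"
    and b: "\<And>i. i \<le> p \<Longrightarrow> b i \<in> canonical_directions p"
    and q: "\<And>i. i \<le> p \<Longrightarrow> q i \<in> cube p (l + 1) a"
    and distinct: "\<And>i j. i \<le> p \<Longrightarrow> j \<le> p \<Longrightarrow> i \<noteq> j \<Longrightarrow> \<exists>m. red (b i $ m) \<noteq> red (b j $ m)"
    and coord: "\<And>i m. i \<le> p \<Longrightarrow> red (b i $ m) = c i * u m + d i * v m"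
    and X: "X = (\<Union>i\<le>p. line_through (q i) (b i) \<inter> cube p l a) - cube p (l + 1) a"
  shows "(of_nat (card (hyperplane e x \<inter> X)) :: 'q mod_ring) = 0"
proof -
  define T where "T i = {t. pairing (q i - x) e + t * pairing (b i) e = 0 \<and>
    of_nat p ^ l dvd t \<and> \<not> of_nat p ^ (l + 1) dvd t}" for i
  define A where "A i = (\<lambda>t. q i + t *s b i) ` T i" for i
  have "hyperplane e x \<inter> X = (\<Union>i\<le>p. A i)"
  proof -
    have "hyperplane e x \<inter> (line_through (q i) (b i) \<inter> cube p l a - cube p (l + 1) a) = A i" if "i \<le> p" for i
      using line_mem_cube_iff[OF q[OF that] _ b[OF that]]
      by (auto simp: A_def T_def line_through_def hyperplane_def pairing_line)
    then show ?thesis unfolding X by blast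
  qed
  \<comment> \<open>At a common point \<open>t *s b i\<close> and \<open>t' *s b j\<close> agree
    modulo p^(l+1). Dividing by p^l makes the two directions proportional modulo p, with a nonzero
    factor \<open>red s\<close>, contrary to \<open>distinct\<close>.\<close>
  moreover have "A i \<inter> A j = {}" if "i \<le> p" "j \<le> p" "i \<noteq> j" for i j
  proof (rule ccontr)
    assume "A i \<inter> A j \<noteq> {}"
    then obtain t t' where t: "t \<in> T i" "t' \<in> T j" and eq: "q i + t *s b i = q j + t' *s b j"
      by (auto simp: A_def)
    obtain s s' where s: "t = of_nat p ^ l * s" "t' = of_nat p ^ l * s'"
      using t unfolding T_def by (auto elim!: dvdE)
    have "red s * red (b i $ m) = red s' * red (b j $ m)" for m
    proof -
      have "q i $ m + t * b i $ m = q j $ m + t' * b j $ m"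
        using arg_cong[OF eq, of "\<lambda>y. y $ m"] by simp
      then have "of_nat p ^ l * (s * b i $ m - s' * b j $ m) = (q j $ m - a $ m) - (q i $ m - a $ m)"
        unfolding s by (simp add: algebra_simps)
      moreover have "of_nat p ^ (l + 1) dvd (q j $ m - a $ m) - (q i $ m - a $ m)"
        using q[OF that(1)] q[OF that(2)] unfolding cube_def cong_pow_def by (blast intro: dvd_diff)
      ultimately have "of_nat p ^ Suc l dvd of_nat p ^ l * (s * b i $ m - s' * b j $ m)" by simp
      then have "of_nat p dvd s * b i $ m - s' * b j $ m"
        using l by (intro pow_Suc_dvd_cancel) auto
      then show ?thesis unfolding red_eq_0_iff[symmetric] by simp
    qed
    moreover have "red s \<noteq> 0"
    proof
      assume "red s = 0"
      then have "of_nat p ^ (l + 1) dvd t"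
        unfolding s red_eq_0_iff power_add power_one_right by (rule mult_dvd_mono[OF dvd_refl])
      then show False using t unfolding T_def by blast
    qed
    ultimately show False
      using distinct[OF that] canonical_proportional_red_eq[OF b[OF that(1)] b[OF that(2)]] by blast
  qed
  moreover have "card (A i) = card (T i)" if "i \<le> p" for i
  proof -
    obtain m where m: "b i $ m = 1" using canonical_coordinate_1[OF b[OF \<open>i \<le> p\<close>]] ..
    have "inj_on (\<lambda>t. q i + t *s b i) (T i)"
    proof (rule inj_onI)
      fix t t' assume "q i + t *s b i = q i + t' *s b i"
      then have "(t *s b i) $ m = (t' *s b i) $ m" by simp
      then show "t = t'" using m by simp
    qed
    then show ?thesis unfolding A_def by (rule card_image)
  qed
  ultimately have "card (hyperplane e x \<inter> X) = (\<Sum>i\<le>p. card (T i))"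
    using card_UN_disjoint[of "{..p}" A] by (simp add: A_def)
  then have sum: "(of_nat (card (hyperplane e x \<inter> X)) :: 'q mod_ring) = (\<Sum>i\<le>p. of_nat (card (T i)))"
    by simp
  \<comment> \<open>The condition on the constant term in \<open>card_line_solutions\<close>, taken
    at the centre \<open>a\<close> so that it is the same for all \<open>i\<close>.\<close>
  define E where "E \<longleftrightarrow> of_nat p ^ l dvd pairing (a - x) e \<and> \<not> of_nat p ^ (l + 1) dvd pairing (a - x) e"
  \<comment> \<open>On vectors \<open>c * u + d * v\<close> over Z/p, the pairing with
    \<open>e\<close> modulo p is the linear form \<open>c * r + d * s\<close>.\<close>
  define r where "r = (\<Sum>m\<in>UNIV. u m * red (e $ m))"
  define s where "s = (\<Sum>m\<in>UNIV. v m * red (e $ m))"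
  have card_T: "(of_nat (card (T i)) :: 'q mod_ring) = (if c i * r + d i * s \<noteq> 0 \<and> E then 1 else 0)"
    if "i \<le> p" for i
  proof -
    have "cong_pow p (l + 1) (q i) a" using q[OF that] unfolding cube_def by simp
    moreover from this have "cong_pow p l (q i) a" by (rule cong_pow_mono) simp
    ultimately have "E \<longleftrightarrow> of_nat p ^ l dvd pairing (q i - x) e \<and> \<not> of_nat p ^ (l + 1) dvd pairing (q i - x) e"
      unfolding E_def using pow_dvd_pairing by blast
    moreover have "red (pairing (b i) e) = c i * r + d i * s"
      unfolding pairing_def r_def s_def
      by (simp add: coord[OF that] sum_distrib_left algebra_simps flip: sum.distrib)
    ultimately show ?thesis unfolding T_def card_line_solutions[OF l] by simp
  qed
  \<comment> \<open>A zero determinant yields two proportionalities between the directions, with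
    factors \<open>d j\<close> and \<open>c j\<close> on the side of \<open>b i\<close>. One of
    these factors is nonzero because \<open>b j\<close> has a coordinate 1.\<close>
  have "c i * d j - c j * d i \<noteq> 0" if "i \<le> p" "j \<le> p" "i \<noteq> j" for i j
  proof
    assume "c i * d j - c j * d i = 0"
    then have det: "c i * d j = c j * d i" by simp
    have "d j * red (b i $ m) = d i * red (b j $ m)" for m
    proof -
      have "d j * red (b i $ m) = (c i * d j) * u m + d i * d j * v m"
        using coord[OF that(1)] by (simp add: algebra_simps)
      also have "\<dots> = d i * red (b j $ m)" unfolding det
        using coord[OF that(2)] by (simp add: algebra_simps)
      finally show ?thesis .
    qed
    moreover have "c j * red (b i $ m) = c i * red (b j $ m)" for m
    proof -
      have "c j * red (b i $ m) = c i * c j * u m + (c j * d i) * v m"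
        using coord[OF that(1)] by (simp add: algebra_simps)
      also have "\<dots> = c i * red (b j $ m)" unfolding det[symmetric]
        using coord[OF that(2)] by (simp add: algebra_simps)
      finally show ?thesis .
    qed
    moreover have "c j \<noteq> 0 \<or> d j \<noteq> 0"
    proof -
      obtain m where "b j $ m = 1" using canonical_coordinate_1[OF b[OF \<open>j \<le> p\<close>]] ..
      then show ?thesis using coord[OF that(2), of m] by auto
    qed
    ultimately show False
      using distinct[OF that] canonical_proportional_red_eq[OF b[OF that(1)] b[OF that(2)]] by blast
  qed
  then have "(of_nat (card {i. i \<le> p \<and> c i * r + d i * s \<noteq> 0}) :: 'q mod_ring) = 0"
    by (intro of_nat_F_eq_0 card_projective_line_nonzero)
  moreover have "{i \<in> {..p}. c i * r + d i * s \<noteq> 0} = {i. i \<le> p \<and> c i * r + d i * s \<noteq> 0}" by auto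
  ultimately show ?thesis unfolding sum
    by (cases E) (simp_all add: card_T flip: sum.inter_filter)
qed

section \<open>Reduction of both kinds of fan to a common form\<close>

lemma line_through_line_direction:
  fixes L :: "('r, 'n::{finite,linorder}) rvec set"
  assumes "is_line L"
  shows "line_direction p L \<in> canonical_directions p"
    and "y \<in> L \<Longrightarrow> L = line_through y (line_direction p L)"
proof -
  have *: "line_direction p L \<in> canonical_directions p \<and> (\<exists>a. L = line_through a (line_direction p L))"
    unfolding line_direction_def by (rule theI'[OF line_canonical_direction[OF prime_p card_R assms]])
  then show "line_direction p L \<in> canonical_directions p" ..
  obtain a where a: "L = line_through a (line_direction p L)" using * by blast
  assume "y \<in> L"
  then obtain s where y: "y = a + s *s line_direction p L"
    using a by (auto simp: line_through_def)
  have "a + t *s line_direction p L = y + (t - s) *s line_direction p L"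
    and "y + t *s line_direction p L = a + (s + t) *s line_direction p L" for t
    unfolding y by (simp_all add: vec_eq_iff algebra_simps)
  then have "line_through a (line_direction p L) = line_through y (line_direction p L)"
    unfolding line_through_def by blast
  then show "L = line_through y (line_direction p L)" using a by simp
qed

text \<open>If the directions agreed modulo p, then \<open>s = 1\<close> would compete in the
  maximum, as k is positive, and the angle would be at most 1/p.\<close>

lemma angle_1_red_neq:
  fixes b c :: "('r, 'n::finite) rvec"
  assumes "angle p k b c = 1"
  shows "\<exists>m. red (b $ m) \<noteq> red (c $ m)"
proof (rule ccontr)
  assume "\<nexists>m. red (b $ m) \<noteq> red (c $ m)"
  then have "of_nat p dvd b $ m - c $ m" for m
    using red_eq_0_iff[of "b $ m - c $ m"] by simp
  then have "1 \<in> {s. s \<le> k \<and> cong_pow p s b c}"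
    using k_pos by (simp add: cong_pow_def)
  then have "Max {s. s \<le> k \<and> cong_pow p s b c} \<ge> 1" by (intro Max_ge) auto
  then have "real p ^ Max {s. s \<le> k \<and> cong_pow p s b c} > 1"
    using prime_gt_1_nat[OF prime_p] by (intro one_less_power) auto
  then show False using assms by (simp add: angle_def power_int_minus)
qed

text \<open>To cancel p^l, the coefficients \<open>c\<close> and \<open>d\<close> must first be
  shown divisible by it. This holds because \<open>u\<close> and \<open>v\<close> are independent
  modulo p and so have an invertible 2 by 2 minor.\<close>

lemma two_plane_coordinates:
  fixes u v w :: "('r, 'n::{finite,linorder}) rvec"
  assumes u: "u \<in> canonical_directions p" and v: "v \<in> canonical_directions p"
    and angle: "angle p k u v = 1" and "l < k"
    and cong: "cong_pow p (l + 1) (of_nat p ^ l *s w) (c *s u + d *s v)"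
  shows "\<exists>c' d'. \<forall>m. red (w $ m) = c' * red (u $ m) + d' * red (v $ m)"
proof -
  have dvd: "of_nat p ^ l dvd c * u $ m + d * v $ m" for m
  proof -
    have "of_nat p ^ (l + 1) dvd of_nat p ^ l * w $ m - (c * u $ m + d * v $ m)"
      using cong by (auto simp: cong_pow_def)
    then have "of_nat p ^ l dvd of_nat p ^ l * w $ m - (c * u $ m + d * v $ m)"
      by (rule dvd_trans[rotated]) (simp add: le_imp_power_dvd)
    then have "of_nat p ^ l dvd of_nat p ^ l * w $ m - (of_nat p ^ l * w $ m - (c * u $ m + d * v $ m))"
      by (rule dvd_diff[OF dvd_triv_left])
    also have "\<dots> = c * u $ m + d * v $ m" by simp
    finally show ?thesis .
  qed
  obtain i where i: "u $ i = 1" using canonical_coordinate_1[OF u] ..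
  \<comment> \<open>As \<open>u $ i = 1\<close>, this entry is the minor of \<open>u\<close> and
    \<open>v\<close> at the coordinates \<open>i\<close> and \<open>m\<close>.\<close>
  have "\<exists>m. red (v $ m - v $ i * u $ m) \<noteq> 0"
  proof (rule ccontr)
    assume "\<nexists>m. red (v $ m - v $ i * u $ m) \<noteq> 0"
    then have "red (v $ m) - red (v $ i) * red (u $ m) = 0" for m
      unfolding red_diff red_mult by blast
    then have "1 * red (v $ m) = red (v $ i) * red (u $ m)" for m
      unfolding mult_1 right_minus_eq .
    then have "red (v $ m) = red (u $ m)" for m
      by (rule canonical_proportional_red_eq[OF v u]) simp
    then show False using angle_1_red_neq[OF angle] by simp
  qed
  then obtain m where "red (v $ m - v $ i * u $ m) \<noteq> 0" ..
  then obtain z where z: "1 = (v $ m - v $ i * u $ m) * z" using dvd_1_iff_red by (metis dvdE)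
  \<comment> \<open>Coordinate \<open>i\<close> eliminates \<open>c\<close> and leaves
    \<open>d\<close> times the invertible minor.\<close>
  have "of_nat p ^ l dvd (c * u $ m + d * v $ m) - (c * u $ i + d * v $ i) * u $ m"
    by (intro dvd_diff dvd_mult2 dvd)
  also have "\<dots> = d * (v $ m - v $ i * u $ m)" by (simp add: i algebra_simps)
  finally have "of_nat p ^ l dvd d * (v $ m - v $ i * u $ m) * z" by (rule dvd_mult2)
  then have d: "of_nat p ^ l dvd d" using z by (simp add: mult.assoc)
  have "of_nat p ^ l dvd (c * u $ i + d * v $ i) - d * v $ i" by (intro dvd_diff dvd dvd_mult2 d)
  then have c: "of_nat p ^ l dvd c" using i by simp
  obtain c' d' where cd: "c = of_nat p ^ l * c'" "d = of_nat p ^ l * d'" using c d by (auto elim!: dvdE)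
  have "red (w $ m) = red c' * red (u $ m) + red d' * red (v $ m)" for m
  proof -
    have "of_nat p ^ Suc l dvd of_nat p ^ l * (w $ m - (c' * u $ m + d' * v $ m))"
      using cong unfolding cong_pow_def cd by (auto simp: algebra_simps)
    then have "of_nat p dvd w $ m - (c' * u $ m + d' * v $ m)"
      using \<open>l < k\<close> by (rule pow_Suc_dvd_cancel)
    then show ?thesis unfolding red_eq_0_iff[symmetric] by simp
  qed
  then show ?thesis by blast
qed

text \<open>The ultrametric property that every point of a cube is a centre lets \<open>Q\<close>
  and \<open>Q'\<close> be centred at the same \<open>a\<close>.\<close>

lemma cube_eq:
  fixes a x :: "('r, 'n::finite) rvec"
  assumes "a \<in> cube p l x"
  shows "cube p l x = cube p l a"
proof -
  have "of_nat p ^ l dvd a $ i - x $ i" for i using assms by (simp add: cube_def cong_pow_def)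
  then have "of_nat p ^ l dvd (y $ i - a $ i) + (a $ i - x $ i) \<longleftrightarrow> of_nat p ^ l dvd y $ i - a $ i"
    for y :: "('r, 'n) rvec" and i by (rule dvd_add_left_iff)
  then show ?thesis by (simp add: cube_def cong_pow_def)
qed

text \<open>In dimension 2 the two unit vectors serve as \<open>u\<close> and \<open>v\<close>;
  otherwise the reductions of the vectors spanning the 2-plane do.\<close>

lemma fan_normal_form:
  fixes X :: "('r, 'n::{finite,linorder}) rvec set"
  assumes "is_fan p k X"
  obtains l L and a :: "('r, 'n) rvec" and u v c d where
    "l + 2 \<le> k" "\<forall>i\<le>p. is_line (L i) \<and> L i \<inter> cube p (l + 1) a \<noteq> {}"
    "\<forall>i\<le>p. \<forall>j\<le>p. i \<noteq> j \<longrightarrow> line_angle p k (L i) (L j) = 1"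
    "\<forall>i\<le>p. \<forall>m. red (line_direction p (L i) $ m) = c i * u m + d i * v m"
    "X = (\<Union>i\<le>p. L i \<inter> cube p l a) - cube p (l + 1) a"
proof (cases "CARD('n) = 2")
  case True
  then obtain l Q Q' L a x where fan: "l + 2 \<le> k"
    "Q = cube p (l + 1) a" "Q' = cube p l x" "Q \<subseteq> Q'"
    "\<forall>i\<le>p. is_line (L i) \<and> L i \<inter> Q \<noteq> {}"
    "\<forall>i\<le>p. \<forall>j\<le>p. i \<noteq> j \<longrightarrow> line_angle p k (L i) (L j) = 1"
    "X = (\<Union>i\<le>p. L i \<inter> Q') - Q"
    using assms unfolding is_fan_def is_fan_planar_def by auto
  have "a \<in> Q" unfolding fan cube_def cong_pow_def by simp
  then have Q': "Q' = cube p l a" using cube_eq fan by blast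
  obtain m1 m2 :: 'n where UNIV: "UNIV = {m1, m2}" "m1 \<noteq> m2" using True by (auto simp: card_2_iff)
  define c d where "c i = red (line_direction p (L i) $ m1)"
    and "d i = red (line_direction p (L i) $ m2)" for i
  define u v :: "'n \<Rightarrow> 'q mod_ring" where "u m = of_bool (m = m1)" and "v m = of_bool (m = m2)" for m
  have coord: "\<forall>i\<le>p. \<forall>m. red (line_direction p (L i) $ m) = c i * u m + d i * v m"
  proof (intro allI impI)
    show "red (line_direction p (L i) $ m) = c i * u m + d i * v m" for i m
      using UNIV UNIV_I[of m] by (auto simp: c_def d_def u_def v_def)
  qed
  show ?thesis
    by (rule that[OF fan(1) fan(5)[unfolded fan(2)] fan(6) coord fan(7)[unfolded Q' fan(2)]])
next
  case False
  then obtain l Q Q' a P\<^sub>0 P L x where fan: "l + 2 \<le> k" "Q' = cube p l x" "a \<in> Q'"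
    "is_two_plane_through p k a P\<^sub>0" "P = Q' \<inter> nbhd p (l + 1) P\<^sub>0" "Q = cube p (l + 1) a"
    "\<forall>i\<le>p. is_line (L i) \<and> L i \<inter> Q \<noteq> {}"
    "\<forall>i\<le>p. \<forall>j\<le>p. i \<noteq> j \<longrightarrow> line_angle p k (L i) (L j) = 1"
    "\<forall>j\<le>p. L j \<inter> Q' \<subseteq> P" "X = (\<Union>i\<le>p. L i \<inter> Q') - Q"
    using assms unfolding is_fan_def is_fan_higher_def by auto
  have Q': "Q' = cube p l a" using cube_eq fan by blast
  obtain u v where uv: "u \<in> canonical_directions p" "v \<in> canonical_directions p" "angle p k u v = 1"
    and P\<^sub>0: "P\<^sub>0 = {a + (c *s u + d *s v) | c d. True}"
    using fan(4) by (auto simp: is_two_plane_through_def)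
  have "\<exists>c d. \<forall>m. red (line_direction p (L i) $ m) = c * red (u $ m) + d * red (v $ m)" if "i \<le> p" for i
  proof -
    define b where "b = line_direction p (L i)"
    obtain q where q: "q \<in> L i" "q \<in> cube p (l + 1) a"
      using fan(7)[unfolded fan(6)] \<open>i \<le> p\<close> by blast
    have b: "b \<in> canonical_directions p" and L: "L i = line_through q b"
      unfolding b_def using line_through_line_direction[of "L i"] q fan(7) that by simp_all
    \<comment> \<open>A step of size exactly p^l stays in \<open>Q'\<close> but is still seen modulo
      p^(l+1), so the containment in \<open>P\<close> constrains \<open>b\<close> modulo p.\<close>
    have "q + of_nat p ^ l *s b \<in> L i" unfolding L line_through_def by blast
    moreover have "q + of_nat p ^ l *s b \<in> Q'"
      unfolding Q' line_mem_cube_iff[OF q(2) le_add1 b] by simp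
    ultimately have "q + of_nat p ^ l *s b \<in> P" using fan(9) that by blast
    then obtain c d where "cong_pow p (l + 1) (q + of_nat p ^ l *s b) (a + (c *s u + d *s v))"
      unfolding fan(5) nbhd_def P\<^sub>0 by blast
    moreover have "cong_pow p (l + 1) q a" using q by (simp add: cube_def)
    ultimately have "of_nat p ^ (l + 1) dvd
      ((q + of_nat p ^ l *s b) $ m - (a + (c *s u + d *s v)) $ m) - (q $ m - a $ m)" for m
      unfolding cong_pow_def by (blast intro: dvd_diff)
    then have "cong_pow p (l + 1) (of_nat p ^ l *s b) (c *s u + d *s v)"
      unfolding cong_pow_def by (simp add: algebra_simps)
    moreover have "l < k" using fan(1) by simp
    ultimately show ?thesis unfolding b_def by (intro two_plane_coordinates[OF uv])
  qed
  then obtain c d where coord: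
    "\<forall>i\<le>p. \<forall>m. red (line_direction p (L i) $ m) = c i * red (u $ m) + d i * red (v $ m)"
    by metis
  show ?thesis
    by (rule that[OF fan(1) fan(7)[unfolded fan(6)] fan(8) coord fan(10)[unfolded Q' fan(6)]])
qed

section \<open>From hyperplanes to their span\<close>

lemma sum_hyperplane_fan:
  fixes X :: "('r, 'n::{finite,linorder}) rvec set"
  assumes "is_fan p k X"
  shows "(\<Sum>y\<in>UNIV. indicator (hyperplane e x) y * indicator X y) = (0 :: 'q mod_ring)"
proof -
  obtain l L and a :: "('r, 'n) rvec" and u v c d where fan:
    "l + 2 \<le> k" "\<forall>i\<le>p. is_line (L i) \<and> L i \<inter> cube p (l + 1) a \<noteq> {}"
    "\<forall>i\<le>p. \<forall>j\<le>p. i \<noteq> j \<longrightarrow> line_angle p k (L i) (L j) = 1"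
    "\<forall>i\<le>p. \<forall>m. red (line_direction p (L i) $ m) = c i * u m + d i * v m"
    "X = (\<Union>i\<le>p. L i \<inter> cube p l a) - cube p (l + 1) a"
    using assms by (rule fan_normal_form)
  define b where "b i = line_direction p (L i)" for i
  have "\<forall>i. \<exists>y. i \<le> p \<longrightarrow> y \<in> L i \<inter> cube p (l + 1) a" using fan(2) by blast
  then obtain q where q: "\<And>i. i \<le> p \<Longrightarrow> q i \<in> L i \<inter> cube p (l + 1) a" by metis
  have L: "L i = line_through (q i) (b i)" if "i \<le> p" for i
    unfolding b_def using line_through_line_direction(2) fan(2) q that by blast
  have "(of_nat (card (hyperplane e x \<inter> X)) :: 'q mod_ring) = 0"
  proof (rule fan_inter_hyperplane_card[OF fan(1)])
    show "b i \<in> canonical_directions p" if "i \<le> p" for i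
      unfolding b_def using line_through_line_direction(1) fan(2) that by blast
    show "q i \<in> cube p (l + 1) a" if "i \<le> p" for i using q[OF that] by blast
    show "\<exists>m. red (b i $ m) \<noteq> red (b j $ m)" if "i \<le> p" "j \<le> p" "i \<noteq> j" for i j
      unfolding b_def using angle_1_red_neq fan(3) that unfolding line_angle_def by blast
    show "red (b i $ m) = c i * u m + d i * v m" if "i \<le> p" for i m
      unfolding b_def using fan(4) that by blast
    show "X = (\<Union>i\<le>p. line_through (q i) (b i) \<inter> cube p l a) - cube p (l + 1) a"
      unfolding fan(5) using L by simp
  qed
  moreover have "(\<Sum>y\<in>UNIV. indicator (hyperplane e x) y * indicator X y) =
      (of_nat (card (hyperplane e x \<inter> X)) :: 'q mod_ring)"
    by (simp only: indicator_inter_arith[symmetric]) (simp add: indicator_def Collect_conj_eq)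
  ultimately show ?thesis by simp
qed

end

theorem theorem8p3:
  fixes p k :: nat
    and f :: "('r::nontriv, 'n::{finite,linorder}) rvec \<Rightarrow> 'q::nontriv mod_ring"
    and X :: "('r, 'n) rvec set"
  assumes "prime p"
    and "CARD('r) = p ^ k"
    and "CARD('q) = p"
    and "CARD('n) \<ge> 2"
    and "f \<in> hyperplane_span"
    and "is_fan p k X"
  shows "(\<Sum>x\<in>UNIV. f x * indicator X x) = 0"
proof -
  interpret prime_power_residues p k "TYPE('r)" "TYPE('q)" using assms by unfold_locales
  interpret Modules.module "\<lambda>(c :: 'q mod_ring) (g :: ('r, 'n) rvec \<Rightarrow> 'q mod_ring) x. c * g x"
    by (rule module_functions)
  \<comment> \<open>The condition is linear in \<open>f\<close>, so it suffices to check it on the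
    spanning indicators.\<close>
  show ?thesis
    using assms(5) unfolding hyperplane_span_def
  proof (rule span_induct)
    show "subspace {g :: ('r, 'n) rvec \<Rightarrow> 'q mod_ring. (\<Sum>x\<in>UNIV. g x * indicator X x) = 0}"
      by (rule subspaceI) (simp_all add: distrib_right sum.distrib mult.assoc flip: sum_distrib_left)
  qed (use sum_hyperplane_fan[OF assms(6)] in blast)
qed

end
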